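(* Let $\mathcal D$ be a derivation in PLC. Then $\mathcal D$ has a unique minimal label.
   Context: Ordinary formulas. Let $\mathcal V=\{X,Y,Z,\dots\}$ be a countable set of propositional variables and $\perp$ a constant. Ordinary formulas are built from $\mathcal V\cup\{\perp\}$ using $\wedge,\vee,\to$; $\neg A$ abbreviates $A\to\perp$. Mixed formulas. Let $\mathcal V_m=\{X_m:X\in\mathcal V\}$, $\mathcal V_i=\{X_i:X\in\mathcal V\}$, $\mathcal V_c=\{X_c:X\in\mathcal V\}$ be three disjoint indexed copies of $\mathcal V$ (minimal, intuitionistic and classical variables). Mixed formulas are built from $\mathcal V_m\cup\mathcal V_i\cup\mathcal V_c\cup\{\perp\}$ using $\wedge,\vee,\to$, with $\neg A=A\to\perp$. A mixed formula is classical if all its variables are in $\mathcal V_c$, and intuitionistic if all its variables are in $\mathcal V_i\cup\mathcal V_c$. Rules. Sequents are $\Gamma\vdash A$ with $\Gamma\cup\{A\}$ a finite set of formulas; commas denote union. Derivations are trees of rule applications. Basic rules ($j\in\{1,2\}$): (Ax) $A\vdash A$; (W) from $\Gamma\vdash A$ infer $\Gamma,B\vdash A$; ($\wedge_I$) from $\Gamma_1\vdash A_1$ and $\Gamma_2\vdash A_2$ infer $\Gamma_1,\Gamma_2\vdash A_1\wedge A_2$; ($\wedge_E$) from $\Gamma\vdash A_1\wedge A_2$ infer $\Gamma\vdash A_j$; ($\vee_I$) from $\Gamma\vdash A_j$ infer $\Gamma\vdash A_1\vee A_2$; ($\vee_E$) from $\Gamma_1\vdash A_1\vee A_2$, $\Gamma_2,A_1\vdash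 B$ and $\Gamma_3,A_2\vdash B$ infer $\Gamma_1,\Gamma_2,\Gamma_3\vdash B$; ($\to_I$) from $\Gamma,A_1\vdash A_2$ infer $\Gamma\vdash A_1\to A_2$; ($\to_E$) from $\Gamma_1\vdash A_1\to A_2$ and $\Gamma_2\vdash A_1$ infer $\Gamma_1,\Gamma_2\vdash A_2$. Absurdity rules: ($\perp_i$) from $\Gamma\vdash\perp$ infer $\Gamma\vdash A$; ($\perp_c$) from $\Gamma\vdash\neg\neg A$ infer $\Gamma\vdash A$. Classical logic PLC consists of all these rules on ordinary formulas, with $A$ arbitrary in both absurdity rules. The system PML consists of all these rules on mixed formulas, with $(\perp_i)$ restricted to intuitionistic mixed formulas $A$ and $(\perp_c)$ restricted to classical mixed formulas $A$. Labels. A label is a function $l$ on $\mathcal V$ with $l(X)\in\{X_m,X_i,X_c\}$ for every $X\in\mathcal V$; it is extended to ordinary formulas by $l(\perp)=\perp$ and $l(A\diamond B)=l(A)\diamond l(B)$ for $\diamond\in\{\wedge,\vee,\to\}$, and to derivations by applying $l$ to every formula occurring in the derivation (keeping the rule names). With $X_m<X_i<X_c$ for each $X$, put $l<l'$ iff $l(X)\le l'(X)$ for all $X\in\mathcal V$ and $l(X)<l'(X)$ for some $X\in\mathcal V$; $l\le l'$ means $l<l'$ or $l=l'$. For a derivation $\mathcal D$ in PLC, a label for $\mathcal D$ is a label $l$ such that (1) $l(X)=X_m$ for every variable $X$ not appearing in $\mathcal D$, and (2) extending $l$ to $\mathcal D$ yields a derivation in PML. A minimal label for $\mathcal D$ is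 a label $l$ for $\mathcal D$ such that every label $l'$ for $\mathcal D$ with $l'\le l$ satisfies $l'=l$. *)

theory Defs
  imports Main "HOL-Library.Countable" "HOL-Library.FSet"
begin

datatype (vars: 'a) form =
    Var 'a
  | Bot (\<open>\<^bold>\<bottom>\<close>)
  | Conj "'a form" "'a form" (infixr \<open>\<^bold>\<and>\<close> 75)
  | Disj "'a form" "'a form" (infixr \<open>\<^bold>\<or>\<close> 70)
  | Imp "'a form" "'a form" (infixr \<open>\<^bold>\<longrightarrow>\<close> 65)

abbreviation Neg :: "'a form \<Rightarrow> 'a form" (\<open>\<^bold>\<not> _\<close> [80] 80)
  where "\<^bold>\<not> A \<equiv> A \<^bold>\<longrightarrow> \<^bold>\<bottom>"

text \<open>The three disjoint copies of the set of variables are the ranges of the three constructors.\<close>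

datatype 'v mvar = Minl 'v | Intu 'v | Clas 'v

type_synonym 'v mform = "'v mvar form"

definition classical :: "'v mform \<Rightarrow> bool"
  where "classical A \<longleftrightarrow> vars A \<subseteq> range Clas"

definition intuitionistic :: "'v mform \<Rightarrow> bool"
  where "intuitionistic A \<longleftrightarrow> vars A \<subseteq> range Intu \<union> range Clas"

datatype 'f sequent = Sequent "'f fset" 'f (infix \<open>\<turnstile>\<close> 60)

datatype rule_name =
  Ax | W | ConjI | ConjE | DisjI | DisjE | ImpI | ImpE | BotI | BotC

text \<open>
  \<open>rule_app P Q r ps s\<close>: the sequent \<open>s\<close> follows from the list of premises \<open>ps\<close> by one
  application of the rule named \<open>r\<close>. The predicates \<open>P\<close> and \<open>Q\<close> say which formulas \<open>A\<close> may be
  introduced by the intuitionistic and by the classical absurdity rule.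
  A comma in a sequent is a union, so in \<open>finsert A \<Gamma>\<close> the formula \<open>A\<close> may already belong
  to \<open>\<Gamma>\<close>.
\<close>

inductive rule_app ::
  "('a form \<Rightarrow> bool) \<Rightarrow> ('a form \<Rightarrow> bool) \<Rightarrow> rule_name \<Rightarrow>
    'a form sequent list \<Rightarrow> 'a form sequent \<Rightarrow> bool"
  for P Q :: "'a form \<Rightarrow> bool"
where
  Ax: "rule_app P Q Ax [] ({|A|} \<turnstile> A)"
| W: "rule_app P Q W [\<Gamma> \<turnstile> A] (finsert B \<Gamma> \<turnstile> A)"
| ConjI: "rule_app P Q ConjI [\<Gamma>1 \<turnstile> A1, \<Gamma>2 \<turnstile> A2] (\<Gamma>1 |\<union>| \<Gamma>2 \<turnstile> (A1 \<^bold>\<and> A2))"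
| ConjE1: "rule_app P Q ConjE [\<Gamma> \<turnstile> (A1 \<^bold>\<and> A2)] (\<Gamma> \<turnstile> A1)"
| ConjE2: "rule_app P Q ConjE [\<Gamma> \<turnstile> (A1 \<^bold>\<and> A2)] (\<Gamma> \<turnstile> A2)"
| DisjI1: "rule_app P Q DisjI [\<Gamma> \<turnstile> A1] (\<Gamma> \<turnstile> (A1 \<^bold>\<or> A2))"
| DisjI2: "rule_app P Q DisjI [\<Gamma> \<turnstile> A2] (\<Gamma> \<turnstile> (A1 \<^bold>\<or> A2))"
| DisjE: "rule_app P Q DisjE
    [\<Gamma>1 \<turnstile> (A1 \<^bold>\<or> A2), finsert A1 \<Gamma>2 \<turnstile> B, finsert A2 \<Gamma>3 \<turnstile> B] (\<Gamma>1 |\<union>| \<Gamma>2 |\<union>| \<Gamma>3 \<turnstile> B)"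
| ImpI: "rule_app P Q ImpI [finsert A1 \<Gamma> \<turnstile> A2] (\<Gamma> \<turnstile> (A1 \<^bold>\<longrightarrow> A2))"
| ImpE: "rule_app P Q ImpE [\<Gamma>1 \<turnstile> (A1 \<^bold>\<longrightarrow> A2), \<Gamma>2 \<turnstile> A1] (\<Gamma>1 |\<union>| \<Gamma>2 \<turnstile> A2)"
| BotI: "P A \<Longrightarrow> rule_app P Q BotI [\<Gamma> \<turnstile> \<^bold>\<bottom>] (\<Gamma> \<turnstile> A)"
| BotC: "Q A \<Longrightarrow> rule_app P Q BotC [\<Gamma> \<turnstile> \<^bold>\<not> \<^bold>\<not> A] (\<Gamma> \<turnstile> A)"

datatype (formulas: 'f) tree =
  Node rule_name (concl: "'f sequent") "'f tree list"

inductive derivation :: "('a form \<Rightarrow> bool) \<Rightarrow> ('a form \<Rightarrow> bool) \<Rightarrow> 'a form tree \<Rightarrow> bool"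
  for P Q :: "'a form \<Rightarrow> bool"
where
  "\<lbrakk>\<forall>D \<in> set Ds. derivation P Q D; rule_app P Q r (map concl Ds) s\<rbrakk>
    \<Longrightarrow> derivation P Q (Node r s Ds)"

definition PLC_derivation :: "'v form tree \<Rightarrow> bool"
  where "PLC_derivation = derivation (\<lambda>_. True) (\<lambda>_. True)"

definition PML_derivation :: "'v mform tree \<Rightarrow> bool"
  where "PML_derivation = derivation intuitionistic classical"

definition is_label :: "('v \<Rightarrow> 'v mvar) \<Rightarrow> bool"
  where "is_label l \<longleftrightarrow> (\<forall>X. l X \<in> {Minl X, Intu X, Clas X})"

definition label_form :: "('v \<Rightarrow> 'v mvar) \<Rightarrow> 'v form \<Rightarrow> 'v mform"
  where "label_form l = map_form l"

definition label_tree :: "('v \<Rightarrow> 'v mvar) \<Rightarrow> 'v form tree \<Rightarrow> 'v mform tree"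
  where "label_tree l = map_tree (label_form l)"

definition mvar_less :: "'v mvar \<Rightarrow> 'v mvar \<Rightarrow> bool"
  where "mvar_less a b \<longleftrightarrow>
    (\<exists>X. (a, b) \<in> {(Minl X, Intu X), (Minl X, Clas X), (Intu X, Clas X)})"

definition mvar_le :: "'v mvar \<Rightarrow> 'v mvar \<Rightarrow> bool"
  where "mvar_le a b \<longleftrightarrow> mvar_less a b \<or> a = b"

definition label_less :: "('v \<Rightarrow> 'v mvar) \<Rightarrow> ('v \<Rightarrow> 'v mvar) \<Rightarrow> bool"
  where "label_less l l' \<longleftrightarrow> (\<forall>X. mvar_le (l X) (l' X)) \<and> (\<exists>X. mvar_less (l X) (l' X))"

definition label_le :: "('v \<Rightarrow> 'v mvar) \<Rightarrow> ('v \<Rightarrow> 'v mvar) \<Rightarrow> bool"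
  where "label_le l l' \<longleftrightarrow> label_less l l' \<or> l = l'"

definition appears_in :: "'v \<Rightarrow> 'v form tree \<Rightarrow> bool"
  where "appears_in X D \<longleftrightarrow> (\<exists>A \<in> formulas D. X \<in> vars A)"

definition label_for :: "'v form tree \<Rightarrow> ('v \<Rightarrow> 'v mvar) \<Rightarrow> bool"
  where "label_for D l \<longleftrightarrow>
    is_label l \<and> (\<forall>X. \<not> appears_in X D \<longrightarrow> l X = Minl X) \<and> PML_derivation (label_tree l D)"

definition minimal_label :: "'v form tree \<Rightarrow> ('v \<Rightarrow> 'v mvar) \<Rightarrow> bool"
  where "minimal_label D l \<longleftrightarrow>
    label_for D l \<and> (\<forall>l'. label_for D l' \<and> label_le l' l \<longrightarrow> l' = l)"

end

theory Submission
  imports Defs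
begin

text \<open>
  Every rule other than the two absurdity rules is schematic in its formulas and carries no side
  condition, so it survives any substitution of variables for variables.  Hence labelling a
  derivation in PLC can only fail at an application of \<open>BotI\<close> or \<open>BotC\<close>, and there the side
  condition is read off variable by variable: every variable of the formula introduced must be
  labelled at least intuitionistic, respectively classical.  The labels for \<open>D\<close> are therefore the
  labels above a pointwise lower bound, with the variables foreign to \<open>D\<close> kept minimal
  (\<open>label_for_iff\<close>).  The bound itself is such a label, because the variables it raises do occur
  in \<open>D\<close>.  So the set of labels for \<open>D\<close> has a least element, and a least element is the
  only minimal one.
\<close>

fun succedent :: "'f sequent \<Rightarrow> 'f"
  where "succedent (\<Gamma> \<turnstile> A) = A"

fun introduced_by :: "rule_name \<Rightarrow> 'f tree \<Rightarrow> 'f set"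
  where "introduced_by r (Node r' s Ds) =
    (if r' = r then {succedent s} else {}) \<union> (\<Union>D \<in> set Ds. introduced_by r D)"

lemma introduced_by_subset_formulas: "introduced_by r D \<subseteq> formulas D"
proof (induction D)
  case (Node r' s Ds)
  have "succedent s \<in> set_sequent s"
    by (cases s) simp
  with Node show ?case
    by auto
qed

text \<open>
  Substituting variables by \<open>f\<close> preserves the shape of each rule, so only the side conditions are
  left to check.  Conversely, the name of the rule determines which side condition was
  satisfied.
\<close>

lemma rule_app_map_iff:
  assumes "rule_app (\<lambda>_. True) (\<lambda>_. True) r ps s"
  shows "rule_app P Q r (map (map_sequent (map_form f)) ps) (map_sequent (map_form f) s) \<longleftrightarrow>
    (r = BotI \<longrightarrow> P (map_form f (succedent s))) \<and> (r = BotC \<longrightarrow> Q (map_form f (succedent s)))"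
  using assms
  by cases (auto simp: fimage_funion elim: rule_app.cases intro: rule_app.intros)

lemma derivation_map_iff:
  assumes "derivation (\<lambda>_. True) (\<lambda>_. True) D"
  shows "derivation P Q (map_tree (map_form f) D) \<longleftrightarrow>
    (\<forall>A \<in> introduced_by BotI D. P (map_form f A)) \<and>
    (\<forall>A \<in> introduced_by BotC D. Q (map_form f A))"
  using assms
proof (induction rule: derivation.induct)
  case (1 Ds r s)
  have concls: "map concl (map (map_tree (map_form f)) Ds) =
      map (map_sequent (map_form f)) (map concl Ds)"
    by (simp add: tree.map_sel)
  have "derivation P Q (map_tree (map_form f) (Node r s Ds)) \<longleftrightarrow>
      (\<forall>D \<in> set Ds. derivation P Q (map_tree (map_form f) D)) \<and>
      rule_app P Q r (map (map_sequent (map_form f)) (map concl Ds)) (map_sequent (map_form f) s)"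
    unfolding concls[symmetric] by (subst derivation.simps) simp
  also note rule_app_map_iff[OF \<open>rule_app (\<lambda>_. True) (\<lambda>_. True) r (map concl Ds) s\<close>]
  finally show ?case
    using 1 by auto
qed

definition absurd_vars :: "rule_name \<Rightarrow> 'v form tree \<Rightarrow> 'v set"
  where "absurd_vars r D = (\<Union>A \<in> introduced_by r D. vars A)"

lemma appears_in_if_absurd_vars: "X \<in> absurd_vars r D \<Longrightarrow> appears_in X D"
  using introduced_by_subset_formulas unfolding absurd_vars_def appears_in_def by fastforce

text \<open>
  The classical case takes precedence: a variable in \<open>absurd_vars BotC D\<close> must be classical, and
  this also satisfies whatever \<open>BotI\<close> asks of it.
\<close>

definition least_label :: "'v form tree \<Rightarrow> 'v \<Rightarrow> 'v mvar"
  where "least_label D X =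
    (if X \<in> absurd_vars BotC D then Clas X
     else if X \<in> absurd_vars BotI D then Intu X else Minl X)"

lemma mvar_le_least_label_iff:
  assumes "is_label l"
  shows "mvar_le (least_label D X) (l X) \<longleftrightarrow>
    (X \<in> absurd_vars BotI D \<longrightarrow> l X \<in> range Intu \<union> range Clas) \<and>
    (X \<in> absurd_vars BotC D \<longrightarrow> l X \<in> range Clas)"
proof -
  from assms have "l X \<in> {Minl X, Intu X, Clas X}"
    by (simp add: is_label_def)
  then show ?thesis
    by (auto simp: least_label_def mvar_le_def mvar_less_def)
qed

text \<open>
  The side conditions of \<open>BotI\<close> and \<open>BotC\<close> quantify over the variables of the introduced
  formulas, so together they become one pointwise inequality.
\<close>

lemma label_for_iff:
  assumes "PLC_derivation D"
  shows "label_for D l \<longleftrightarrow> is_label l \<and> (\<forall>X. \<not> appears_in X D \<longrightarrow> l X = Minl X) \<and>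
    (\<forall>X. mvar_le (least_label D X) (l X))"
proof -
  have "PML_derivation (label_tree l D) \<longleftrightarrow>
      (\<forall>X \<in> absurd_vars BotI D. l X \<in> range Intu \<union> range Clas) \<and>
      (\<forall>X \<in> absurd_vars BotC D. l X \<in> range Clas)"
    using assms
    unfolding PLC_derivation_def PML_derivation_def label_tree_def label_form_def absurd_vars_def
    by (simp add: derivation_map_iff intuitionistic_def classical_def form.set_map image_subset_iff)
  then show ?thesis
    by (auto simp: label_for_def mvar_le_least_label_iff)
qed

lemma label_for_least_label:
  assumes "PLC_derivation D"
  shows "label_for D (least_label D)"
proof -
  have "is_label (least_label D)"
    by (simp add: is_label_def least_label_def)
  moreover have "\<forall>X. \<not> appears_in X D \<longrightarrow> least_label D X = Minl X"
    using appears_in_if_absurd_vars by (fastforce simp: least_label_def)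
  ultimately show ?thesis
    using assms by (simp add: label_for_iff mvar_le_def)
qed

lemma label_le_iff: "label_le l l' \<longleftrightarrow> (\<forall>X. mvar_le (l X) (l' X))"
  unfolding label_le_def label_less_def mvar_le_def by blast

lemma mvar_le_antisym: "mvar_le a b \<Longrightarrow> mvar_le b a \<Longrightarrow> a = b"
  by (auto simp: mvar_le_def mvar_less_def)

lemma label_le_antisym: "label_le l l' \<Longrightarrow> label_le l' l \<Longrightarrow> l = l'"
  unfolding label_le_iff using mvar_le_antisym by blast

theorem theorem48:
  fixes D :: "'v::countable form tree"
  assumes "PLC_derivation D"
  shows "\<exists>!l. minimal_label D l"
proof -
  have least: "label_le (least_label D) l" if "label_for D l" for l
    using that assms by (simp add: label_for_iff label_le_iff)
  show ?thesis
  proof (rule ex1I)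
    show "minimal_label D (least_label D)"
      using label_for_least_label[OF assms] least label_le_antisym
      unfolding minimal_label_def by blast
  next
    show "l = least_label D" if "minimal_label D l" for l
      using that label_for_least_label[OF assms] least
      unfolding minimal_label_def by blast
  qed
qed

end
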